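(* Let $k$ be a positive integer and let $H$ be an induced subgraph of the hypercube $Q_k$. If $|H|$ (the number of vertices of $H$) is a power of $2$, then there exists a positive integer $n$ such that the vertex set of $Q_n$ can be partitioned into $H$-sets.
   Context: For a positive integer $n$, the hypercube $Q_n$ is the graph with vertex set $\{0,1\}^n$ in which two $n$-tuples are adjacent if and only if they differ in exactly one entry. For finite graphs $G, H$, a set $A \subset V(G)$ is an $H$-set if the induced subgraph $G[A]$ is isomorphic to $H$. *)

theory Defs
  imports "Graph_Theory.Graph_Theory" "HOL-Library.Disjoint_Sets"
begin

text \<open>Undirected graphs are symmetric digraphs without loops and parallel arcs, that is,
  instances of the locale \<open>graph\<close>; an edge between \<open>u\<close> and \<open>v\<close> is the pair of arcs
  \<open>(u, v)\<close> and \<open>(v, u)\<close>. The entries \<open>0\<close> and \<open>1\<close> of an \<open>n\<close>-tuple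
  are represented by \<open>False\<close> and \<open>True\<close>.\<close>

definition hypercube :: "nat \<Rightarrow> bool list pair_pre_digraph" where
  "hypercube n = \<lparr> pverts = {v. length v = n},
     parcs = {(u, v). length u = n \<and> length v = n \<and> (\<exists>!i. i < n \<and> u ! i \<noteq> v ! i)} \<rparr>"

definition H_set :: "('a, 'b) pre_digraph \<Rightarrow> ('c, 'd) pre_digraph \<Rightarrow> 'c set \<Rightarrow> bool" where
  "H_set H G A \<longleftrightarrow> A \<subseteq> verts G \<and> digraph_iso (G \<restriction> A) H"

lemma graph_hypercube: "graph (hypercube n)"
proof -
  have fin: "finite {v :: bool list. length v = n}"
    using finite_lists_length_eq[of "UNIV :: bool set" n] by simp
  have sub: "parcs (hypercube n) \<subseteq> {v. length v = n} \<times> {v. length v = n}"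
    by (auto simp: hypercube_def)
  have sym: "(v, u) \<in> parcs (hypercube n)" if uv: "(u, v) \<in> parcs (hypercube n)" for u v
  proof -
    have ex: "\<exists>!i. i < n \<and> u ! i \<noteq> v ! i"
      using uv by (simp add: hypercube_def)
    have "(\<lambda>i. i < n \<and> u ! i \<noteq> v ! i) = (\<lambda>i. i < n \<and> v ! i \<noteq> u ! i)"
      by (rule ext) blast
    from ex[unfolded this] show ?thesis
      using uv by (simp add: hypercube_def)
  qed
  have "pair_graph (hypercube n)"
  proof
    show "fst e \<in> pverts (hypercube n)" if "e \<in> parcs (hypercube n)" for e
      using that sub by (auto simp: hypercube_def)
    show "snd e \<in> pverts (hypercube n)" if "e \<in> parcs (hypercube n)" for e
      using that sub by (auto simp: hypercube_def)
    show "fst e \<noteq> snd e" if "e \<in> parcs (hypercube n)" for e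
    proof
      assume "fst e = snd e"
      with that show False
        by (simp add: hypercube_def case_prod_beta Ex1_def)
    qed
    show "finite (pverts (hypercube n))"
      using fin by (simp add: hypercube_def)
    show "finite (parcs (hypercube n))"
      using finite_subset[OF sub] fin by simp
    show "symmetric (hypercube n)"
      using sym by (simp add: symmetric_def sym_def)
  qed
  then show ?thesis
    by (rule pair_graph.pair_graphD_graph)
qed

end

theory Submission
  imports Defs "HOL-Number_Theory.Cong"
begin

text \<open>Call a subset of a cube good if it can be partitioned into tiles (isometric copies of the
  vertex set \<open>X\<close> of \<open>H\<close>), and cogood if its complement is good. With \<open>r = 2\<^sup>m\<close> the size of
  \<open>X\<close>, the translates of \<open>X\<close> cover every point of the cube exactly \<open>r\<close> times. On the other hand,
  as \<open>X\<close> is nonempty, some sum of translates covers every point an odd number of times. If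
  \<open>f\<close> and \<open>h\<close> are multiplicities of such covers, with \<open>f\<close> congruent to 1 modulo \<open>2\<close> and \<open>h\<close>
  modulo \<open>2\<^sup>j\<close>, then \<open>1 - (1 - h)(1 - f)\<close> is congruent to 1 modulo \<open>2\<^bsup>j+1\<^esup>\<close> and is again a
  combination of tiles on the product cube. So some list \<open>A\<^sub>1, \<dots>, A\<^sub>N\<close> of tiles covers every point
  \<open>1 (mod r)\<close> times.

  It then suffices to find subsets \<open>B\<^sub>1, \<dots>, B\<^sub>N\<close> of another cube such that for every point \<open>x\<close>
  the \<open>B\<^sub>i\<close> with \<open>x \<in> A\<^sub>i\<close> are disjoint and the complement of their union is good: the
  products \<open>A\<^sub>i \<times> B\<^sub>i\<close> are then disjoint and what they leave of each fibre is good. Working in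
  separate coordinates for separate points, this reduces to finding, for each
  \<open>w \<equiv> 1 (mod r)\<close>, some \<open>w\<close> disjoint cogood sets whose union is cogood; and by subdividing one of
  the sets repeatedly, to the case \<open>w = r + 1\<close>. For the latter, the complements of the translates of
  \<open>X\<close> are cogood sets with empty intersection; their number is brought down to two, and from two
  disjoint cogood sets all the others are built by products.\<close>

subsection \<open>Cubes and their products\<close>

definition cube :: "nat \<Rightarrow> bool list set" where
  "cube n = {v. length v = n}"

text \<open>Products are handled as sets of pairs and flattened only at the end: \<open>cat\<close>
  is injective on \<open>cube n \<times> cube m\<close>, so it commutes there with differences and
  intersections.\<close>

definition cat :: "(bool list \<times> bool list) set \<Rightarrow> bool list set" where
  "cat Z = (\<lambda>(a, b). a @ b) ` Z"

lemma finite_cube [simp]: "finite (cube n)"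
  using finite_lists_length_eq[of "UNIV :: bool set" n] by (simp add: cube_def)

lemma cube_0 [simp]: "cube 0 = {[]}"
  by (auto simp: cube_def)

lemma cube_Suc: "cube (Suc n) = Cons False ` cube n \<union> Cons True ` cube n"
proof -
  have "v \<in> Cons False ` cube n \<union> Cons True ` cube n" if "length v = Suc n" for v
    using that by (cases v; cases "hd v") (auto simp: cube_def)
  then show ?thesis by (auto simp: cube_def)
qed

lemma inj_on_append: "inj_on (\<lambda>(a, b). a @ b) (cube n \<times> cube m)"
  by (auto simp: inj_on_def cube_def)

lemma cat_cube: "cat (cube n \<times> cube m) = cube (n + m)"
proof -
  have "v \<in> cat (cube n \<times> cube m)" if "length v = n + m" for v
    unfolding cat_def
    by (rule image_eqI[of _ _ "(take n v, drop n v)"]) (use that in \<open>auto simp: cube_def\<close>)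
  then show ?thesis by (auto simp: cat_def cube_def)
qed

lemma cat_mono: "Z \<subseteq> W \<Longrightarrow> cat Z \<subseteq> cat W"
  by (auto simp: cat_def)

lemma cat_UN: "cat (\<Union>i\<in>I. Z i) = (\<Union>i\<in>I. cat (Z i))"
  by (auto simp: cat_def)

lemma cat_Un: "cat (Z \<union> W) = cat Z \<union> cat W"
  by (auto simp: cat_def)

lemma cat_Diff:
  "Z \<subseteq> cube n \<times> cube m \<Longrightarrow> W \<subseteq> cube n \<times> cube m \<Longrightarrow> cat (Z - W) = cat Z - cat W"
  unfolding cat_def by (rule inj_on_image_set_diff[OF inj_on_append]) auto

lemma cat_Int:
  "Z \<subseteq> cube n \<times> cube m \<Longrightarrow> W \<subseteq> cube n \<times> cube m \<Longrightarrow> cat (Z \<inter> W) = cat Z \<inter> cat W"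
  unfolding cat_def by (rule inj_on_image_Int[OF inj_on_append]) auto

lemma cat_disjoint:
  "Z \<subseteq> cube n \<times> cube m \<Longrightarrow> W \<subseteq> cube n \<times> cube m \<Longrightarrow> Z \<inter> W = {} \<Longrightarrow> cat Z \<inter> cat W = {}"
  by (metis cat_Int cat_def image_empty)

lemma append_mem_cat_iff:
  "Z \<subseteq> cube n \<times> cube m \<Longrightarrow> a \<in> cube n \<Longrightarrow> b \<in> cube m \<Longrightarrow> a @ b \<in> cat Z \<longleftrightarrow> (a, b) \<in> Z"
  by (force simp: cat_def cube_def)

lemma cubeE:
  assumes "v \<in> cube (n + m)"
  obtains a b where "v = a @ b" "a \<in> cube n" "b \<in> cube m"
  using assms unfolding cat_cube[symmetric] by (auto simp: cat_def)

text \<open>A first coordinate lying in some \<open>B i\<close> determines \<open>i\<close>, so the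
  second coordinate then has to avoid this one \<open>C i\<close> only.\<close>

lemma Diff_UN_Times_fst:
  assumes "disjoint_family_on B I" "\<And>i. i \<in> I \<Longrightarrow> B i \<subseteq> S"
  shows "S \<times> T - (\<Union>i\<in>I. B i \<times> C i) = (S - (\<Union>i\<in>I. B i)) \<times> T \<union> (\<Union>i\<in>I. B i \<times> (T - C i))"
proof -
  have "i = j" if "i \<in> I" "j \<in> I" "x \<in> B i" "x \<in> B j" for i j x
    using assms(1) that by (auto simp: disjoint_family_on_def)
  then show ?thesis using assms(2) by blast
qed

lemma Diff_UN_Times_snd:
  assumes "disjoint_family_on C I" "\<And>i. i \<in> I \<Longrightarrow> C i \<subseteq> T"
  shows "S \<times> T - (\<Union>i\<in>I. B i \<times> C i) = S \<times> (T - (\<Union>i\<in>I. C i)) \<union> (\<Union>i\<in>I. (S - B i) \<times> C i)"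
proof -
  have "i = j" if "i \<in> I" "j \<in> I" "x \<in> C i" "x \<in> C j" for i j x
    using assms(1) that by (auto simp: disjoint_family_on_def)
  then show ?thesis using assms(2) by blast
qed

section \<open>Multiplicities of covers\<close>

definition cover_count :: "'a set list \<Rightarrow> 'a \<Rightarrow> nat" where
  "cover_count As x = length (filter (\<lambda>A. x \<in> A) As)"

lemma cover_count_append: "cover_count (As @ Bs) x = cover_count As x + cover_count Bs x"
  by (simp add: cover_count_def)

lemma cover_count_concat_replicate:
  "cover_count (concat (replicate c As)) x = c * cover_count As x"
  by (induction c) (auto simp: cover_count_def)

lemma cover_count_conv_card: "cover_count As x = card {i. i < length As \<and> x \<in> As ! i}"
  by (simp add: cover_count_def length_filter_conv_card)

subsection \<open>Good and cogood sets\<close>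

text \<open>The properties of tiles on which the construction rests. Closure under adding constant
  coordinates on either side is what allows product cubes to be tiled fibre by fibre.\<close>

locale cube_tiles =
  fixes tile :: "nat \<Rightarrow> bool list set \<Rightarrow> bool"
  assumes tile_subset: "tile n A \<Longrightarrow> A \<subseteq> cube n"
    and tile_nonempty: "tile n A \<Longrightarrow> A \<noteq> {}"
    and tile_append: "tile n A \<Longrightarrow> z \<in> cube m \<Longrightarrow> tile (n + m) ((\<lambda>a. a @ z) ` A)"
    and tile_prepend: "tile n A \<Longrightarrow> z \<in> cube m \<Longrightarrow> tile (m + n) ((\<lambda>a. z @ a) ` A)"
begin

definition good :: "nat \<Rightarrow> bool list set \<Rightarrow> bool" where
  "good n A \<longleftrightarrow> (\<exists>P. partition_on A P \<and> (\<forall>B\<in>P. tile n B))"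

definition cogood :: "nat \<Rightarrow> bool list set \<Rightarrow> bool" where
  "cogood n B \<longleftrightarrow> B \<subseteq> cube n \<and> good n (cube n - B)"

lemma good_subset: "good n A \<Longrightarrow> A \<subseteq> cube n"
  unfolding good_def partition_on_def using tile_subset by blast

lemma good_empty [simp]: "good n {}"
  unfolding good_def by (intro exI[of _ "{}"]) (simp add: partition_on_def)

lemma good_tile: "tile n A \<Longrightarrow> good n A"
  unfolding good_def using tile_nonempty
  by (intro exI[of _ "{A}"]) (auto simp: partition_on_def disjoint_def)

lemma good_UN:
  assumes "\<And>i. i \<in> I \<Longrightarrow> good n (A i)" and "disjoint_family_on A I"
  shows "good n (\<Union>i\<in>I. A i)"
proof -
  obtain P where P: "\<And>i. i \<in> I \<Longrightarrow> partition_on (A i) (P i)"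
    and tile: "\<And>i B. i \<in> I \<Longrightarrow> B \<in> P i \<Longrightarrow> tile n B"
    using assms(1) unfolding good_def by metis
  have "partition_on (\<Union>i\<in>I. A i) (\<Union>i\<in>I. P i)"
  proof (rule partition_onI)
    show "\<Union> (\<Union>i\<in>I. P i) = (\<Union>i\<in>I. A i)"
      using P unfolding partition_on_def by blast
  next
    show "{} \<notin> (\<Union>i\<in>I. P i)" using tile tile_nonempty by blast
  next
    fix p q assume "p \<in> (\<Union>i\<in>I. P i)" "q \<in> (\<Union>i\<in>I. P i)" "p \<noteq> q"
    then obtain i j where ij: "i \<in> I" "j \<in> I" "p \<in> P i" "q \<in> P j" by blast
    show "disjnt p q"
    proof (cases "i = j")
      case True
      then show ?thesis
        using P[of i] ij \<open>p \<noteq> q\<close> unfolding partition_on_def disjoint_def disjnt_def by blast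
    next
      case False
      then have "A i \<inter> A j = {}" using assms(2) ij by (auto simp: disjoint_family_on_def)
      moreover have "p \<subseteq> A i" "q \<subseteq> A j" using P ij unfolding partition_on_def by blast+
      ultimately show ?thesis unfolding disjnt_def by blast
    qed
  qed
  then show ?thesis unfolding good_def using tile by blast
qed

lemma good_Un:
  assumes "good n A" "good n B" "A \<inter> B = {}"
  shows "good n (A \<union> B)"
proof -
  have "good n (\<Union>i\<in>{True, False}. if i then A else B)"
    by (rule good_UN) (use assms in \<open>auto simp: disjoint_family_on_def\<close>)
  then show ?thesis by (simp add: Un_commute)
qed

lemma good_image:
  assumes "good n A" "inj_on f A" "\<And>B. tile n B \<Longrightarrow> B \<subseteq> A \<Longrightarrow> tile m (f ` B)"
  shows "good m (f ` A)"
proof -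
  obtain P where P: "partition_on A P" "\<And>B. B \<in> P \<Longrightarrow> tile n B"
    using assms(1) unfolding good_def by blast
  have sub: "B \<subseteq> A" if "B \<in> P" for B using P(1) that by (auto simp: partition_on_def)
  have "partition_on (f ` A) ((`) f ` P)"
  proof (rule partition_onI)
    show "\<Union> ((`) f ` P) = f ` A" using P(1) by (auto simp: partition_on_def)
  next
    show "{} \<notin> (`) f ` P" using P(2) tile_nonempty by blast
  next
    fix p q assume "p \<in> (`) f ` P" "q \<in> (`) f ` P" "p \<noteq> q"
    then obtain B C where BC: "B \<in> P" "C \<in> P" "p = f ` B" "q = f ` C" "B \<noteq> C" by blast
    then have "B \<inter> C = {}" using P(1) by (auto simp: partition_on_def disjoint_def)
    then have "f ` B \<inter> f ` C = {}"
      using inj_on_image_Int[OF assms(2) sub[OF BC(1)] sub[OF BC(2)]] by simp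
    then show "disjnt p q" using BC by (simp add: disjnt_def)
  qed
  moreover have "\<forall>B\<in>(`) f ` P. tile m B" using P(2) sub assms(3) by blast
  ultimately show ?thesis unfolding good_def by blast
qed

text \<open>Each fibre is tiled by itself, possibly differently from the others; appending
  \<open>b\<close> moves its tiles into the product cube.\<close>

lemma good_cat_fst:
  assumes Z: "Z \<subseteq> cube n \<times> cube m" and g: "\<And>b. b \<in> cube m \<Longrightarrow> good n {a. (a, b) \<in> Z}"
  shows "good (n + m) (cat Z)"
proof -
  have "cat Z = (\<Union>b\<in>cube m. (\<lambda>a. a @ b) ` {a. (a, b) \<in> Z})"
    using Z by (force simp: cat_def)
  moreover have "good (n + m) (\<Union>b\<in>cube m. (\<lambda>a. a @ b) ` {a. (a, b) \<in> Z})"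
  proof (rule good_UN)
    fix b assume b: "b \<in> cube m"
    show "good (n + m) ((\<lambda>a. a @ b) ` {a. (a, b) \<in> Z})"
      by (rule good_image[OF g[OF b]]) (auto simp: inj_on_def intro: tile_append b)
  next
    show "disjoint_family_on (\<lambda>b. (\<lambda>a. a @ b) ` {a. (a, b) \<in> Z}) (cube m)"
      by (force simp: disjoint_family_on_def cube_def)
  qed
  ultimately show ?thesis by simp
qed

lemma good_cat_snd:
  assumes Z: "Z \<subseteq> cube n \<times> cube m" and g: "\<And>a. a \<in> cube n \<Longrightarrow> good m {b. (a, b) \<in> Z}"
  shows "good (n + m) (cat Z)"
proof -
  have "cat Z = (\<Union>a\<in>cube n. (\<lambda>b. a @ b) ` {b. (a, b) \<in> Z})"
    using Z by (force simp: cat_def)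
  moreover have "good (n + m) (\<Union>a\<in>cube n. (\<lambda>b. a @ b) ` {b. (a, b) \<in> Z})"
  proof (rule good_UN)
    fix a assume a: "a \<in> cube n"
    show "good (n + m) ((\<lambda>b. a @ b) ` {b. (a, b) \<in> Z})"
      by (rule good_image[OF g[OF a]]) (auto simp: inj_on_def intro: tile_prepend a)
  next
    show "disjoint_family_on (\<lambda>a. (\<lambda>b. a @ b) ` {b. (a, b) \<in> Z}) (cube n)"
      using Z by (fastforce simp: disjoint_family_on_def cube_def)
  qed
  ultimately show ?thesis by simp
qed

lemma good_times_left: "good n A \<Longrightarrow> B \<subseteq> cube m \<Longrightarrow> good (n + m) (cat (A \<times> B))"
  by (rule good_cat_fst) (use good_subset in \<open>auto simp: Collect_conj_eq\<close>)

lemma good_times_right: "A \<subseteq> cube n \<Longrightarrow> good m B \<Longrightarrow> good (n + m) (cat (A \<times> B))"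
  by (rule good_cat_snd) (use good_subset in \<open>auto simp: Collect_conj_eq\<close>)

section \<open>Cogood sets and their products\<close>

lemma cogood_cube [simp]: "cogood n (cube n)"
  by (simp add: cogood_def)

lemma cogood_subset: "cogood n B \<Longrightarrow> B \<subseteq> cube n"
  by (simp add: cogood_def)

text \<open>The complement consists of \<open>(cube n - B) \<times> cube m\<close>, tiled along the
  first coordinate, and of the good fibres \<open>cube m - C a\<close> over \<open>B\<close>, tiled
  along the second. That \<open>C a\<close> may vary with \<open>a\<close> is essential for
  \<open>two_disjoint_cogood\<close>.\<close>

lemma cogood_cat_fst:
  assumes B: "cogood n B" and C: "\<And>a. a \<in> B \<Longrightarrow> cogood m (C a)"
  shows "cogood (n + m) (cat (Sigma B C))"
proof -
  have sub: "B \<subseteq> cube n" "\<And>a. a \<in> B \<Longrightarrow> C a \<subseteq> cube m" using B C by (auto simp: cogood_def)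
  then have S: "Sigma B C \<subseteq> cube n \<times> cube m" by blast
  have 1: "good (n + m) (cat ((cube n - B) \<times> cube m))"
    by (rule good_times_left) (use B in \<open>auto simp: cogood_def\<close>)
  have 2: "good (n + m) (cat (SIGMA a:B. cube m - C a))"
  proof (rule good_cat_snd)
    show "(SIGMA a:B. cube m - C a) \<subseteq> cube n \<times> cube m" using sub by blast
    fix a assume "a \<in> cube n"
    show "good m {b. (a, b) \<in> (SIGMA a:B. cube m - C a)}"
      using C[of a] by (cases "a \<in> B") (auto simp: cogood_def set_diff_eq)
  qed
  have "good (n + m) (cat ((cube n - B) \<times> cube m) \<union> cat (SIGMA a:B. cube m - C a))"
    by (rule good_Un[OF 1 2]) (rule cat_disjoint[of _ n m], use sub in auto)
  moreover have "cat ((cube n - B) \<times> cube m) \<union> cat (SIGMA a:B. cube m - C a)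
      = cube (n + m) - cat (Sigma B C)"
  proof -
    have "cube n \<times> cube m - Sigma B C = ((cube n - B) \<times> cube m) \<union> (SIGMA a:B. cube m - C a)"
      using sub by blast
    then show ?thesis
      unfolding cat_cube[symmetric] cat_Diff[OF order_refl S, symmetric] by (simp add: cat_Un)
  qed
  ultimately show ?thesis
    unfolding cogood_def using cat_mono[OF S] by (simp add: cat_cube)
qed

lemma cogood_cat_snd:
  assumes B: "cogood m B" and C: "\<And>b. b \<in> B \<Longrightarrow> cogood n (C b)"
  shows "cogood (n + m) (cat {(a, b). b \<in> B \<and> a \<in> C b})"
proof -
  let ?Z = "{(a, b). b \<in> B \<and> a \<in> C b}" and ?W = "{(a, b). b \<in> B \<and> a \<in> cube n - C b}"
  have sub: "B \<subseteq> cube m" "\<And>b. b \<in> B \<Longrightarrow> C b \<subseteq> cube n" using B C by (auto simp: cogood_def)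
  then have S: "?Z \<subseteq> cube n \<times> cube m" by blast
  have 1: "good (n + m) (cat (cube n \<times> (cube m - B)))"
    by (rule good_times_right) (use B in \<open>auto simp: cogood_def\<close>)
  have 2: "good (n + m) (cat ?W)"
  proof (rule good_cat_fst)
    show "?W \<subseteq> cube n \<times> cube m" using sub by blast
    fix b assume "b \<in> cube m"
    show "good n {a. (a, b) \<in> ?W}"
      using C[of b] by (cases "b \<in> B") (auto simp: cogood_def set_diff_eq)
  qed
  have "good (n + m) (cat (cube n \<times> (cube m - B)) \<union> cat ?W)"
    by (rule good_Un[OF 1 2]) (rule cat_disjoint[of _ n m], use sub in auto)
  moreover have "cat (cube n \<times> (cube m - B)) \<union> cat ?W = cube (n + m) - cat ?Z"
  proof -
    have "cube n \<times> cube m - ?Z = (cube n \<times> (cube m - B)) \<union> ?W"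
      using sub by blast
    then show ?thesis
      unfolding cat_cube[symmetric] cat_Diff[OF order_refl S, symmetric] by (simp add: cat_Un)
  qed
  ultimately show ?thesis
    unfolding cogood_def using cat_mono[OF S] by (simp add: cat_cube)
qed

lemma cogood_times: "cogood n B \<Longrightarrow> cogood m C \<Longrightarrow> cogood (n + m) (cat (B \<times> C))"
  by (rule cogood_cat_fst)

section \<open>Producing disjoint cogood sets\<close>

text \<open>Reduces the number of sets by one as long as there are at least three. Let \<open>t x \<in> {0, 1}\<close> be such
  that \<open>x \<notin> D (t x)\<close> for the points \<open>x\<close> common to all \<open>D i\<close> with \<open>i \<ge> 2\<close>. If \<open>a \<in> D (t b)\<close> and
  \<open>b \<in> D (1 - t a)\<close> for two such points, then \<open>t a \<noteq> t b\<close> by the former and \<open>t a = t b\<close> by the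
  latter.\<close>

lemma two_disjoint_cogood:
  fixes j :: nat
  assumes "j \<ge> 2" "\<And>i. i < j \<Longrightarrow> cogood n (D i)" "(\<Inter>i<j. D i) = {}"
  shows "\<exists>n E F. cogood n E \<and> cogood n F \<and> E \<inter> F = {}"
  using assms
proof (induction j arbitrary: n D rule: dec_induct)
  case base
  have "(\<Inter>i<2. D i) = D 0 \<inter> D 1" by (auto simp: numeral_2_eq_2 lessThan_Suc)
  then show ?case using base(1)[of 0] base(1)[of 1] base(2) by auto
next
  case (step j)
  define t where "t x = (if x \<in> D 0 then 1 else 0 :: nat)" for x
  have t: "t x < 2" for x by (simp add: t_def)
  \<comment> \<open>On the squared cube \<open>D 2\<close> is absorbed into the sets with indices 0
    and 1, whence the shift by one in the remaining indices.\<close>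
  define D' where "D' i = cat (if i = 0 then {(a, b). b \<in> D 2 \<and> a \<in> D (t b)}
    else if i = 1 then SIGMA a:D 2. D (1 - t a) else D (Suc i) \<times> D (Suc i))" for i
  have sub: "i < Suc j \<Longrightarrow> D i \<subseteq> cube n" for i using step.prems(1) cogood_subset by blast
  have "cogood (n + n) (D' i)" if "i < j" for i
  proof -
    consider "i = 0" | "i = 1" | "i \<ge> 2" by linarith
    then show ?thesis
    proof cases
      case 1
      have "cogood (n + n) (cat {(a, b). b \<in> D 2 \<and> a \<in> D (t b)})"
        by (rule cogood_cat_snd) (use step.hyps step.prems(1) in \<open>auto simp: t_def\<close>)
      then show ?thesis using 1 by (simp add: D'_def)
    next
      case 2
      have "cogood (n + n) (cat (SIGMA a:D 2. D (1 - t a)))"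
        by (rule cogood_cat_fst) (use step.hyps step.prems(1) in \<open>auto simp: t_def\<close>)
      then show ?thesis using 2 by (simp add: D'_def)
    next
      case 3
      then show ?thesis unfolding D'_def
        using that step.prems(1) by (auto intro!: cogood_times)
    qed
  qed
  moreover have "(\<Inter>i<j. D' i) = {}"
  proof (rule ccontr)
    assume "(\<Inter>i<j. D' i) \<noteq> {}"
    then obtain z where z: "\<And>i. i < j \<Longrightarrow> z \<in> D' i" by blast
    have "z \<in> D' 0" using z step.hyps by simp
    then obtain a b where ab: "z = a @ b" "b \<in> D 2" "a \<in> D (t b)"
      by (auto simp: D'_def cat_def)
    have l: "a \<in> cube n" "b \<in> cube n"
      using ab sub[of 2] sub[of "t b"] t[of b] step.hyps by auto
    have "a @ b \<in> D' 1" using z step.hyps ab by simp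
    moreover have "(SIGMA a:D 2. D (1 - t a)) \<subseteq> cube n \<times> cube n"
      using sub[of 0] sub[of 1] sub[of 2] step.hyps by (auto simp: t_def split: if_splits)
    ultimately have 1: "a \<in> D 2" "b \<in> D (1 - t a)"
      using l unfolding D'_def by (simp_all add: append_mem_cat_iff)
    have 2: "a \<in> D i \<and> b \<in> D i" if "2 \<le> i" "i < Suc j" for i
    proof (cases "i = 2")
      case True then show ?thesis using 1 ab by simp
    next
      case False
      define k where "k = i - 1"
      have k: "i = Suc k" "k \<ge> 2" "k < j" using that False by (auto simp: k_def)
      then have "a @ b \<in> D' k" using z ab by simp
      then show ?thesis
        using k l Sigma_mono[OF sub[of "Suc k"] sub[of "Suc k"]]
        unfolding D'_def by (simp add: append_mem_cat_iff)
    qed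
    have "x \<notin> D (t x)" if "\<And>i. 2 \<le> i \<Longrightarrow> i < Suc j \<Longrightarrow> x \<in> D i" for x
    proof
      assume "x \<in> D (t x)"
      then have "x \<in> D 0" "x \<in> D 1" by (auto simp: t_def split: if_splits)
      then have "x \<in> D i" if "i < Suc j" for i
        using that \<open>\<And>i. 2 \<le> i \<Longrightarrow> i < Suc j \<Longrightarrow> x \<in> D i\<close>[of i]
        by (cases "i = 0"; cases "i = 1") auto
      then show False using step.prems(2) by blast
    qed
    then have "a \<notin> D (t a)" "b \<notin> D (t b)" using 2 by blast+
    then show False using ab 1 by (auto simp: t_def split: if_splits)
  qed
  ultimately show ?case by (rule step.IH)
qed

text \<open>Induction: a further factor \<open>E\<close> keeps the old \<open>D i\<close> disjoint,
  and \<open>cube d \<times> F\<close> is disjoint from every \<open>D i \<times> E\<close> since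
  \<open>E\<close> and \<open>F\<close> are disjoint.\<close>

lemma disjoint_cogoods:
  fixes N :: nat
  assumes "cogood n E" "cogood n F" "E \<inter> F = {}"
  shows "\<exists>d D. (\<forall>i<N. cogood d (D i)) \<and> disjoint_family_on D {..<N}"
proof (induction N)
  case 0
  show ?case by (simp add: disjoint_family_on_def)
next
  case (Suc N)
  then obtain d D where D: "\<And>i. i < N \<Longrightarrow> cogood d (D i)" "disjoint_family_on D {..<N}" by blast
  define D' where "D' i = cat (if i < N then D i \<times> E else cube d \<times> F)" for i
  have "cogood (d + n) (D' i)" for i
    using D assms by (auto simp: D'_def intro!: cogood_times)
  moreover have "disjoint_family_on D' {..<Suc N}"
    unfolding disjoint_family_on_def
  proof (intro ballI impI)
    fix i j assume ij: "i \<in> {..<Suc N}" "j \<in> {..<Suc N}" "i \<noteq> j"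
    then have "D i \<inter> D j = {}" if "i < N" "j < N"
      using D(2) that by (auto simp: disjoint_family_on_def)
    then show "D' i \<inter> D' j = {}"
      using ij assms(3) cogood_subset[OF assms(1)] cogood_subset[OF assms(2)]
        cogood_subset[OF D(1), of i] cogood_subset[OF D(1), of j]
      unfolding D'_def
      by (intro cat_disjoint[of _ d n]) (auto split: if_splits)
  qed
  ultimately show ?case by blast
qed

subsection \<open>Splitting a cube into cogood sets\<close>

text \<open>As the \<open>B i\<close> lie in the cube, the last conjunct makes their union cogood.
  For \<open>w = 0\<close> it says that \<open>cube d\<close> itself is good, which is the final
  aim.\<close>

definition splittable :: "nat \<Rightarrow> bool" where
  "splittable w \<longleftrightarrow> (\<exists>d B. (\<forall>i<w. cogood d (B i)) \<and> disjoint_family_on B {..<w}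
     \<and> good d (cube d - (\<Union>i<w. B i)))"

text \<open>The union of the \<open>D i \<times> A i\<close> is read in two ways. It is good because
  each \<open>A i\<close> is. Over a point \<open>x\<close> it consists of the \<open>r\<close> sets
  \<open>D i\<close> with \<open>x \<in> A i\<close>; taking the \<open>l\<close>-th of them over
  every \<open>x\<close> gives the cogood set \<open>C l\<close>.\<close>

lemma disjoint_cogoods_good_union:
  fixes M r :: nat
  assumes D: "\<And>i. i < M \<Longrightarrow> cogood n (D i)" and disj: "disjoint_family_on D {..<M}"
    and A: "\<And>i. i < M \<Longrightarrow> good k (A i)"
    and card: "\<And>x. x \<in> cube k \<Longrightarrow> card {i. i < M \<and> x \<in> A i} = r"
  shows "\<exists>d C. (\<forall>l<r. cogood d (C l)) \<and> disjoint_family_on C {..<r} \<and> good d (\<Union>l<r. C l)"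
proof -
  have "\<exists>h. bij_betw h {..<r} {i. i < M \<and> x \<in> A i}" if "x \<in> cube k" for x
    using ex_bij_betw_nat_finite[of "{i. i < M \<and> x \<in> A i}"] card[OF that]
    by (auto simp: atLeast0LessThan)
  then obtain s where s: "\<And>x. x \<in> cube k \<Longrightarrow> bij_betw (s x) {..<r} {i. i < M \<and> x \<in> A i}"
    by metis
  have sM: "s x l < M" "x \<in> A (s x l)" if "x \<in> cube k" "l < r" for x l
    using bij_betwE[OF s[OF that(1)]] that(2) by auto
  define C where "C l = cat {(y, x). x \<in> cube k \<and> y \<in> D (s x l)}" for l
  have Dsub: "D i \<subseteq> cube n" if "i < M" for i using D[OF that] cogood_subset by blast
  have "cogood (n + k) (C l)" if "l < r" for l
    unfolding C_def by (rule cogood_cat_snd) (use that D sM in auto)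
  moreover have "disjoint_family_on C {..<r}"
    unfolding disjoint_family_on_def C_def
  proof (intro ballI impI cat_disjoint[of _ n k])
    fix l m assume lm: "l \<in> {..<r}" "m \<in> {..<r}" "l \<noteq> m"
    have "D (s x l) \<inter> D (s x m) = {}" if x: "x \<in> cube k" for x
    proof -
      have "s x l \<noteq> s x m"
        using lm bij_betw_imp_inj_on[OF s[OF x]] by (auto simp: inj_on_def)
      then show ?thesis using sM[OF x] lm disj by (auto simp: disjoint_family_on_def)
    qed
    then show "{(y, x). x \<in> cube k \<and> y \<in> D (s x l)} \<inter> {(y, x). x \<in> cube k \<and> y \<in> D (s x m)} = {}"
      by blast
  qed (use Dsub sM in blast)+
  moreover have "good (n + k) (\<Union>l<r. C l)"
  proof -
    have "(\<Union>l<r. {(y, x). x \<in> cube k \<and> y \<in> D (s x l)}) = (\<Union>i<M. D i \<times> A i)"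
    proof (intro equalityI subsetI)
      fix p assume "p \<in> (\<Union>i<M. D i \<times> A i)"
      then obtain y x i where p: "p = (y, x)" "i < M" "y \<in> D i" "x \<in> A i" by blast
      then have x: "x \<in> cube k" using A good_subset by blast
      have "i \<in> s x ` {..<r}" using bij_betw_imp_surj_on[OF s[OF x]] p by blast
      then obtain l where "l < r" "s x l = i" by blast
      then show "p \<in> (\<Union>l<r. {(y, x). x \<in> cube k \<and> y \<in> D (s x l)})" using p x by blast
    qed (use sM in blast)
    then have "(\<Union>l<r. C l) = (\<Union>i<M. cat (D i \<times> A i))"
      unfolding C_def cat_UN[symmetric] by simp
    moreover have "good (n + k) (\<Union>i<M. cat (D i \<times> A i))"
    proof (rule good_UN)
      fix i assume "i \<in> {..<M}"
      then show "good (n + k) (cat (D i \<times> A i))" using good_times_right Dsub A by blast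
    next
      show "disjoint_family_on (\<lambda>i. cat (D i \<times> A i)) {..<M}"
        unfolding disjoint_family_on_def
      proof (intro ballI impI cat_disjoint[of _ n k])
        fix i j assume "i \<in> {..<M}" "j \<in> {..<M}" "i \<noteq> j"
        then show "D i \<times> A i \<inter> D j \<times> A j = {}" using disj by (auto simp: disjoint_family_on_def)
      qed (use Dsub A good_subset in blast)+
    qed
    ultimately show ?thesis by simp
  qed
  ultimately show ?thesis by blast
qed

text \<open>What is left over lies above the complement of all \<open>B i\<close>, or in some
  \<open>B i \<times> (cube e - C i)\<close>; both kinds of remainder are good. In
  \<open>simultaneous_splitting\<close> this serves the points already treated.\<close>

lemma good_compl_family_fst:
  assumes B: "disjoint_family_on B I" "good d (cube d - (\<Union>i\<in>I. B i))" "\<And>i. i \<in> I \<Longrightarrow> B i \<subseteq> cube d"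
    and C: "\<And>i. i \<in> I \<Longrightarrow> cogood e (C i)"
  shows "disjoint_family_on (\<lambda>i. cat (B i \<times> C i)) I"
    and "good (d + e) (cube (d + e) - (\<Union>i\<in>I. cat (B i \<times> C i)))"
proof -
  have Csub: "C i \<subseteq> cube e" if "i \<in> I" for i using C[OF that] cogood_subset by blast
  have disj: "disjoint_family_on (\<lambda>i. cat (B i \<times> X i)) I" if "\<And>i. i \<in> I \<Longrightarrow> X i \<subseteq> cube e" for X
    unfolding disjoint_family_on_def
  proof (intro ballI impI cat_disjoint[of _ d e])
    fix i j assume "i \<in> I" "j \<in> I" "i \<noteq> j"
    then show "B i \<times> X i \<inter> B j \<times> X j = {}" using B(1) by (auto simp: disjoint_family_on_def)
  qed (use B(3) that in blast)+
  show "disjoint_family_on (\<lambda>i. cat (B i \<times> C i)) I" by (rule disj[OF Csub])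
  let ?Z = "(cube d - (\<Union>i\<in>I. B i)) \<times> cube e" and ?W = "\<Union>i\<in>I. B i \<times> (cube e - C i)"
  have "good (d + e) (cat ?Z)" by (rule good_times_left[OF B(2) order_refl])
  moreover have "good (d + e) (cat ?W)"
    unfolding cat_UN
  proof (rule good_UN)
    fix i assume "i \<in> I"
    then show "good (d + e) (cat (B i \<times> (cube e - C i)))"
      using B(3) C good_times_right by (auto simp: cogood_def)
  qed (rule disj, blast)
  moreover have "cat ?Z \<inter> cat ?W = {}"
    by (rule cat_disjoint[of _ d e]) (use B(3) in auto)
  ultimately have "good (d + e) (cat ?Z \<union> cat ?W)" by (rule good_Un)
  moreover have "cat ?Z \<union> cat ?W = cube (d + e) - (\<Union>i\<in>I. cat (B i \<times> C i))"
  proof -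
    have U: "(\<Union>i\<in>I. B i \<times> C i) \<subseteq> cube d \<times> cube e" using B(3) Csub by blast
    have "cube d \<times> cube e - (\<Union>i\<in>I. B i \<times> C i) = ?Z \<union> ?W"
      by (rule Diff_UN_Times_fst[OF B(1,3)])
    then show ?thesis
      unfolding cat_cube[symmetric] cat_UN[symmetric] cat_Diff[OF order_refl U, symmetric]
      by (simp add: cat_Un)
  qed
  ultimately show "good (d + e) (cube (d + e) - (\<Union>i\<in>I. cat (B i \<times> C i)))" by simp
qed

text \<open>The mirror image, in which the second factors carry the splitting; it serves the newly
  treated point.\<close>

lemma good_compl_family_snd:
  assumes C: "disjoint_family_on C I" "good e (cube e - (\<Union>i\<in>I. C i))" "\<And>i. i \<in> I \<Longrightarrow> C i \<subseteq> cube e"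
    and B: "\<And>i. i \<in> I \<Longrightarrow> cogood d (B i)"
  shows "disjoint_family_on (\<lambda>i. cat (B i \<times> C i)) I"
    and "good (d + e) (cube (d + e) - (\<Union>i\<in>I. cat (B i \<times> C i)))"
proof -
  have Bsub: "B i \<subseteq> cube d" if "i \<in> I" for i using B[OF that] cogood_subset by blast
  have disj: "disjoint_family_on (\<lambda>i. cat (X i \<times> C i)) I" if "\<And>i. i \<in> I \<Longrightarrow> X i \<subseteq> cube d" for X
    unfolding disjoint_family_on_def
  proof (intro ballI impI cat_disjoint[of _ d e])
    fix i j assume "i \<in> I" "j \<in> I" "i \<noteq> j"
    then show "X i \<times> C i \<inter> X j \<times> C j = {}" using C(1) by (auto simp: disjoint_family_on_def)
  qed (use C(3) that in blast)+
  show "disjoint_family_on (\<lambda>i. cat (B i \<times> C i)) I" by (rule disj[OF Bsub])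
  let ?Z = "cube d \<times> (cube e - (\<Union>i\<in>I. C i))" and ?W = "\<Union>i\<in>I. (cube d - B i) \<times> C i"
  have "good (d + e) (cat ?Z)" by (rule good_times_right[OF order_refl C(2)])
  moreover have "good (d + e) (cat ?W)"
    unfolding cat_UN
  proof (rule good_UN)
    fix i assume "i \<in> I"
    then show "good (d + e) (cat ((cube d - B i) \<times> C i))"
      using C(3) B good_times_left by (auto simp: cogood_def)
  qed (rule disj, blast)
  moreover have "cat ?Z \<inter> cat ?W = {}"
    by (rule cat_disjoint[of _ d e]) (use C(3) in auto)
  ultimately have "good (d + e) (cat ?Z \<union> cat ?W)" by (rule good_Un)
  moreover have "cat ?Z \<union> cat ?W = cube (d + e) - (\<Union>i\<in>I. cat (B i \<times> C i))"
  proof -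
    have U: "(\<Union>i\<in>I. B i \<times> C i) \<subseteq> cube d \<times> cube e" using C(3) Bsub by blast
    have "cube d \<times> cube e - (\<Union>i\<in>I. B i \<times> C i) = ?Z \<union> ?W"
      by (rule Diff_UN_Times_snd[OF C(1,3)])
    then show ?thesis
      unfolding cat_cube[symmetric] cat_UN[symmetric] cat_Diff[OF order_refl U, symmetric]
      by (simp add: cat_Un)
  qed
  ultimately show "good (d + e) (cube (d + e) - (\<Union>i\<in>I. cat (B i \<times> C i)))" by simp
qed

text \<open>The sets are \<open>E \<times> cube e\<close> and \<open>F \<times> C l\<close>. Over the union of the \<open>C l\<close> no property of the
  complement of \<open>E \<union> F\<close> is needed, since that union is itself good.\<close>

lemma splittable_Suc_if_good_union:
  assumes E: "cogood n E" and F: "cogood n F" and EF: "E \<inter> F = {}"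
    and C: "\<And>l. l < r \<Longrightarrow> cogood e (C l)" "disjoint_family_on C {..<r}" "good e (\<Union>l<r. C l)"
  shows "splittable (Suc r)"
proof -
  define B where "B i = cat (if i = 0 then E \<times> cube e else F \<times> C (i - 1))" for i
  define U where "U = (\<Union>l<r. C l)"
  have sub: "E \<subseteq> cube n" "F \<subseteq> cube n" "U \<subseteq> cube e"
    using E F C(3) cogood_subset good_subset by (auto simp: U_def)
  have "cogood (n + e) (B i)" if "i < Suc r" for i
    unfolding B_def using that by (auto intro!: cogood_times E F C(1))
  moreover have "disjoint_family_on B {..<Suc r}"
    unfolding disjoint_family_on_def
  proof (intro ballI impI)
    fix i j assume ij: "i \<in> {..<Suc r}" "j \<in> {..<Suc r}" "i \<noteq> j"
    then have "C (i - 1) \<inter> C (j - 1) = {}" if "i \<noteq> 0" "j \<noteq> 0"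
      using C(2) that by (auto simp: disjoint_family_on_def)
    moreover have "C (l - 1) \<subseteq> cube e" if "l < Suc r" "l \<noteq> 0" for l
      using that C(1)[of "l - 1"] cogood_subset by auto
    ultimately show "B i \<inter> B j = {}"
      unfolding B_def using ij sub EF by (intro cat_disjoint[of _ n e]) auto
  qed
  moreover have "good (n + e) (cube (n + e) - (\<Union>i<Suc r. B i))"
  proof -
    let ?Z = "(cube n - E) \<times> (cube e - U)" and ?W = "(cube n - (E \<union> F)) \<times> U"
    have "good (n + e) (cat ?Z)" by (rule good_times_left) (use E in \<open>auto simp: cogood_def\<close>)
    moreover have "good (n + e) (cat ?W)" by (rule good_times_right) (use C(3) in \<open>auto simp: U_def\<close>)
    moreover have "cat ?Z \<inter> cat ?W = {}" by (rule cat_disjoint[of _ n e]) (use sub in auto)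
    ultimately have "good (n + e) (cat (?Z \<union> ?W))" unfolding cat_Un by (rule good_Un)
    moreover have "?Z \<union> ?W = cube n \<times> cube e - (E \<times> cube e \<union> F \<times> U)" using EF sub by blast
    moreover have "(\<Union>i<Suc r. B i) = cat (E \<times> cube e \<union> F \<times> U)"
    proof -
      have "(\<Union>i<Suc r. B i) = B 0 \<union> (\<Union>i<r. B (Suc i))"
        unfolding lessThan_Suc_eq_insert_0 by simp
      also have "\<dots> = cat (E \<times> cube e) \<union> cat (\<Union>i<r. F \<times> C i)"
        by (simp add: B_def cat_UN)
      also have "(\<Union>i<r. F \<times> C i) = F \<times> U" by (auto simp: U_def)
      finally show ?thesis by (simp add: cat_Un)
    qed
    ultimately show ?thesis
      using sub by (simp add: cat_Diff[of _ n e, symmetric] cat_cube[symmetric] Sigma_mono)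
  qed
  ultimately show ?thesis unfolding splittable_def by blast
qed

lemma splittable_1: "splittable (Suc 0)"
  unfolding splittable_def
  by (intro exI[of _ 0] exI[of _ "\<lambda>_. cube 0"])
    (use cogood_cube[of 0] in \<open>simp add: disjoint_family_on_def lessThan_Suc\<close>)

text \<open>The last set \<open>B v\<close> is replaced by the \<open>Suc r\<close> products
  \<open>B v \<times> C i\<close>, the others by \<open>B i \<times> cube e\<close>. The only new
  remainder is \<open>B v\<close> times the complement of all \<open>C i\<close>, which is good in
  the second factor.\<close>

lemma splittable_add:
  assumes "splittable (Suc v)" "splittable (Suc r)"
  shows "splittable (Suc v + r)"
proof -
  obtain d B where B: "\<And>i. i < Suc v \<Longrightarrow> cogood d (B i)" "disjoint_family_on B {..<Suc v}"
    and gB: "good d (cube d - (\<Union>i<Suc v. B i))"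
    using assms(1) unfolding splittable_def by blast
  obtain e C where C: "\<And>i. i < Suc r \<Longrightarrow> cogood e (C i)" "disjoint_family_on C {..<Suc r}"
    and gC: "good e (cube e - (\<Union>i<Suc r. C i))"
    using assms(2) unfolding splittable_def by blast
  define N where "N i = (if i < v then B i \<times> cube e else B v \<times> C (i - v))" for i
  have Bsub: "B i \<subseteq> cube d" if "i \<le> v" for i using B(1)[of i] that cogood_subset by auto
  have Csub: "C i \<subseteq> cube e" if "i \<le> r" for i using C(1)[of i] that cogood_subset by auto
  have sub: "N i \<subseteq> cube d \<times> cube e" if "i < Suc v + r" for i
  proof -
    have "i - v \<le> r" using that by simp
    then show ?thesis using Bsub[of i] Bsub[of v] Csub[of "i - v"] by (auto simp: N_def)
  qed
  have UC: "(\<Union>i<Suc r. C i) \<subseteq> cube e"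
    using Csub unfolding lessThan_Suc_atMost by blast
  have UB: "(\<Union>i<Suc v. B i) \<subseteq> cube d"
    using Bsub unfolding lessThan_Suc_atMost by blast
  have BB: "B i \<inter> B j = {}" if "i \<le> v" "j \<le> v" "i \<noteq> j" for i j
    using B(2) that by (auto simp: disjoint_family_on_def)
  have CC: "C i \<inter> C j = {}" if "i \<le> r" "j \<le> r" "i \<noteq> j" for i j
    using C(2) that by (auto simp: disjoint_family_on_def)
  have "cogood (d + e) (cat (N i))" if "i < Suc v + r" for i
    unfolding N_def using that by (auto intro!: cogood_times B(1) C(1))
  moreover have "disjoint_family_on (\<lambda>i. cat (N i)) {..<Suc v + r}"
    unfolding disjoint_family_on_def
  proof (intro ballI impI cat_disjoint[of _ d e])
    fix i j assume ij: "i \<in> {..<Suc v + r}" "j \<in> {..<Suc v + r}" "i \<noteq> j"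
    show "N i \<inter> N j = {}"
    proof (cases "i < v \<or> j < v")
      case True
      then have "(if i < v then B i else B v) \<inter> (if j < v then B j else B v) = {}"
        using ij BB by auto
      then show ?thesis by (auto simp: N_def split: if_splits)
    next
      case False
      then have "C (i - v) \<inter> C (j - v) = {}" using ij by (intro CC) auto
      then show ?thesis using False by (auto simp: N_def)
    qed
  qed (use sub in auto)
  moreover have "good (d + e) (cube (d + e) - (\<Union>i<Suc v + r. cat (N i)))"
  proof -
    let ?Z = "(cube d - (\<Union>i<Suc v. B i)) \<times> cube e" and ?W = "B v \<times> (cube e - (\<Union>i<Suc r. C i))"
    have "good (d + e) (cat ?Z)" by (rule good_times_left[OF gB order_refl])
    moreover have "good (d + e) (cat ?W)" by (rule good_times_right[OF Bsub[OF order_refl] gC])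
    moreover have "cat ?Z \<inter> cat ?W = {}" by (rule cat_disjoint[of _ d e]) (use Bsub in auto)
    ultimately have g: "good (d + e) (cat (?Z \<union> ?W))" unfolding cat_Un by (rule good_Un)
    have "(\<Union>i<Suc v + r. N i) = (\<Union>i<v. B i) \<times> cube e \<union> B v \<times> (\<Union>i<Suc r. C i)"
    proof (intro equalityI subsetI)
      fix p assume "p \<in> (\<Union>i<Suc v + r. N i)"
      then obtain i where i: "i < Suc v + r" "p \<in> N i" by blast
      then show "p \<in> (\<Union>i<v. B i) \<times> cube e \<union> B v \<times> (\<Union>i<Suc r. C i)"
        by (cases "i < v") (auto simp: N_def intro!: bexI[of _ "i - v"])
    next
      fix p assume "p \<in> (\<Union>i<v. B i) \<times> cube e \<union> B v \<times> (\<Union>i<Suc r. C i)"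
      then consider i where "i < v" "p \<in> B i \<times> cube e" | i where "i < Suc r" "p \<in> B v \<times> C i"
        by blast
      then show "p \<in> (\<Union>i<Suc v + r. N i)"
      proof cases
        case (1 i) then show ?thesis by (intro UN_I[of i]) (auto simp: N_def)
      next
        case (2 i) then show ?thesis by (intro UN_I[of "v + i"]) (auto simp: N_def)
      qed
    qed
    moreover have "B v \<inter> (\<Union>i<v. B i) = {}"
    proof -
      have "B v \<inter> B i = {}" if "i < v" for i by (rule BB) (use that in auto)
      then show ?thesis by blast
    qed
    ultimately have "cube d \<times> cube e - (\<Union>i<Suc v + r. N i) = ?Z \<union> ?W"
      using UC Bsub[of v] by (simp only: lessThan_Suc UN_insert) blast
    moreover have "(\<Union>i<Suc v + r. N i) \<subseteq> cube d \<times> cube e" using sub by blast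
    ultimately show ?thesis
      using g unfolding cat_UN[symmetric] by (simp add: cat_Diff[of _ d e, symmetric] cat_cube[symmetric])
  qed
  ultimately show ?thesis
    unfolding splittable_def by (intro exI[of _ "d + e"] exI[of _ "\<lambda>i. cat (N i)"]) blast
qed

lemma splittable_arith_prog: "splittable (Suc r) \<Longrightarrow> splittable (Suc (r * m))"
proof (induction m)
  case 0
  show ?case using splittable_1 by simp
next
  case (Suc m)
  then show ?case using splittable_add[of "r * m" r] by (simp add: add.commute)
qed

text \<open>Induction on \<open>P\<close>, with fresh coordinates for each point. These split the
  family at the new point, where the old factors enter only as cogood sets; at the old points the
  roles are exchanged. Hence the claim that every \<open>B i\<close> is cogood.\<close>

lemma simultaneous_splitting:
  fixes I :: "'a \<Rightarrow> 'b set"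
  assumes "finite P" "\<And>x. x \<in> P \<Longrightarrow> finite (I x) \<and> splittable (card (I x))"
  shows "\<exists>d B. (\<forall>i. cogood d (B i)) \<and>
    (\<forall>x\<in>P. disjoint_family_on B (I x) \<and> good d (cube d - (\<Union>i\<in>I x. B i)))"
  using assms
proof (induction P rule: finite_induct)
  case empty
  show ?case
    by (intro exI[of _ 0] exI[of _ "\<lambda>_. cube 0"]) (use cogood_cube[of 0] in simp)
next
  case (insert x P)
  then obtain d B where B: "\<And>i. cogood d (B i)"
    and P: "\<And>y. y \<in> P \<Longrightarrow> disjoint_family_on B (I y)"
      "\<And>y. y \<in> P \<Longrightarrow> good d (cube d - (\<Union>i\<in>I y. B i))" by blast
  obtain e C' where C': "\<And>i. i < card (I x) \<Longrightarrow> cogood e (C' i)" "disjoint_family_on C' {..<card (I x)}"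
    "good e (cube e - (\<Union>i<card (I x). C' i))"
    using insert.prems[of x] unfolding splittable_def by blast
  obtain h where h: "bij_betw h (I x) {..<card (I x)}"
    using insert.prems[of x] ex_bij_betw_finite_nat[of "I x"] by (auto simp: atLeast0LessThan)
  \<comment> \<open>Indices outside \<open>I x\<close> get the whole cube, which is cogood as
    well.\<close>
  define C where "C i = (if i \<in> I x then C' (h i) else cube e)" for i
  have C: "cogood e (C i)" for i
    using C'(1) bij_betwE[OF h] by (auto simp: C_def)
  have "disjoint_family_on C (I x)"
    unfolding disjoint_family_on_def
  proof (intro ballI impI)
    fix i j assume ij: "i \<in> I x" "j \<in> I x" "i \<noteq> j"
    then have "h i \<noteq> h j" using bij_betw_imp_inj_on[OF h] by (auto simp: inj_on_def)
    then show "C i \<inter> C j = {}"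
      using ij C'(2) bij_betwE[OF h] by (auto simp: C_def disjoint_family_on_def)
  qed
  moreover have "(\<Union>i\<in>I x. C i) = (\<Union>i<card (I x). C' i)"
    unfolding bij_betw_imp_surj_on[OF h, symmetric] by (simp add: C_def)
  ultimately have x: "disjoint_family_on (\<lambda>i. cat (B i \<times> C i)) (I x)"
    "good (d + e) (cube (d + e) - (\<Union>i\<in>I x. cat (B i \<times> C i)))"
    using good_compl_family_snd[of C "I x" e d B] C'(3) B C cogood_subset by auto
  have "disjoint_family_on (\<lambda>i. cat (B i \<times> C i)) (I y) \<and>
    good (d + e) (cube (d + e) - (\<Union>i\<in>I y. cat (B i \<times> C i)))" if "y \<in> P" for y
    using good_compl_family_fst[of B "I y" d e C] P[OF that] B C cogood_subset by auto
  moreover have "cogood (d + e) (cat (B i \<times> C i))" for i using cogood_times[OF B C] .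
  ultimately show ?case using x by (intro exI[of _ "d + e"] exI[of _ "\<lambda>i. cat (B i \<times> C i)"]) auto
qed

lemma good_cube_if_splittable:
  fixes A :: "nat \<Rightarrow> bool list set"
  assumes A: "\<And>i. i < N \<Longrightarrow> good k (A i)"
    and split: "\<And>x. x \<in> cube k \<Longrightarrow> splittable (card {i. i < N \<and> x \<in> A i})"
  shows "\<exists>n. good n (cube n)"
proof -
  define I where "I x = {i. i < N \<and> x \<in> A i}" for x
  have "\<exists>d B. (\<forall>i. cogood d (B i)) \<and>
    (\<forall>x\<in>cube k. disjoint_family_on B (I x) \<and> good d (cube d - (\<Union>i\<in>I x. B i)))"
    by (rule simultaneous_splitting) (use split in \<open>auto simp: I_def\<close>)
  then obtain d B where B: "\<And>i. cogood d (B i)"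
    and I: "\<And>x. x \<in> cube k \<Longrightarrow> disjoint_family_on B (I x)"
      "\<And>x. x \<in> cube k \<Longrightarrow> good d (cube d - (\<Union>i\<in>I x. B i))" by blast
  have Asub: "A i \<subseteq> cube k" if "i < N" for i using A[OF that] good_subset by blast
  have Bsub: "B i \<subseteq> cube d" for i using B cogood_subset by blast
  \<comment> \<open>\<open>?Z\<close> is tiled along the first coordinate, where the
    \<open>A i\<close> are good, and \<open>?W\<close> along the second, fibre by fibre.\<close>
  let ?Z = "\<Union>i<N. A i \<times> B i" and ?W = "SIGMA x:cube k. cube d - (\<Union>i\<in>I x. B i)"
  have sub: "?Z \<subseteq> cube k \<times> cube d" using Asub Bsub by blast
  have "good (k + d) (cat ?Z)"
    unfolding cat_UN
  proof (rule good_UN)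
    show "good (k + d) (cat (A i \<times> B i))" if "i \<in> {..<N}" for i
      using good_times_left A Bsub that by blast
    show "disjoint_family_on (\<lambda>i. cat (A i \<times> B i)) {..<N}"
      unfolding disjoint_family_on_def
    proof (intro ballI impI cat_disjoint[of _ k d])
      fix i j assume ij: "i \<in> {..<N}" "j \<in> {..<N}" "i \<noteq> j"
      have "B i \<inter> B j = {}" if "x \<in> A i" "x \<in> A j" for x
        using I(1)[of x] Asub[of i] that ij by (auto simp: disjoint_family_on_def I_def)
      then show "A i \<times> B i \<inter> A j \<times> B j = {}" by blast
    qed (use Asub Bsub in blast)+
  qed
  moreover have "good (k + d) (cat ?W)"
    by (rule good_cat_snd) (use I(2) in \<open>auto simp: set_diff_eq\<close>)
  moreover have "cat ?Z \<inter> cat ?W = {}"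
    by (rule cat_disjoint[OF sub]) (auto simp: I_def)
  ultimately have "good (k + d) (cat (?Z \<union> ?W))" unfolding cat_Un by (rule good_Un)
  moreover have "?Z \<union> ?W = cube k \<times> cube d" using Asub Bsub by (auto simp: I_def)
  ultimately show ?thesis by (auto simp: cat_cube)
qed

subsection \<open>Covers modulo a power of two\<close>

definition realizable :: "nat \<Rightarrow> nat \<Rightarrow> (bool list \<Rightarrow> int) \<Rightarrow> bool" where
  "realizable r n f \<longleftrightarrow> (\<exists>As. (\<forall>A\<in>set As. good n A)
     \<and> (\<forall>x\<in>cube n. [int (cover_count As x) = f x] (mod int r)))"

lemma realizable_zero: "realizable r n (\<lambda>_. 0)"
  unfolding realizable_def by (intro exI[of _ "[]"]) (simp add: cover_count_def)

lemma realizable_good: "good n A \<Longrightarrow> realizable r n (\<lambda>x. of_bool (x \<in> A))"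
  unfolding realizable_def by (intro exI[of _ "[A]"]) (simp add: cover_count_def)

lemma realizable_eq: "realizable r n f \<Longrightarrow> (\<And>x. x \<in> cube n \<Longrightarrow> f x = g x) \<Longrightarrow> realizable r n g"
  unfolding realizable_def by force

lemma realizable_add:
  assumes "realizable r n f" "realizable r n g"
  shows "realizable r n (\<lambda>x. f x + g x)"
proof -
  obtain As Bs where "\<forall>A\<in>set As. good n A" "\<forall>x\<in>cube n. [int (cover_count As x) = f x] (mod int r)"
    "\<forall>A\<in>set Bs. good n A" "\<forall>x\<in>cube n. [int (cover_count Bs x) = g x] (mod int r)"
    using assms unfolding realizable_def by blast
  then show ?thesis unfolding realizable_def
    by (intro exI[of _ "As @ Bs"]) (auto simp: cover_count_append intro: cong_add)
qed

text \<open>The coefficient \<open>c\<close>, possibly negative, is replaced by its least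
  nonnegative residue, and the list is repeated that often. This is why covers are counted modulo
  \<open>r\<close>.\<close>

lemma realizable_scale:
  assumes "realizable r n f" "r > 0"
  shows "realizable r n (\<lambda>x. c * f x)"
proof -
  obtain As where As: "\<forall>A\<in>set As. good n A" "\<forall>x\<in>cube n. [int (cover_count As x) = f x] (mod int r)"
    using assms(1) unfolding realizable_def by blast
  define c' where "c' = nat (c mod int r)"
  have "[int c' = c] (mod int r)"
    using assms(2) by (simp add: c'_def)
  then show ?thesis unfolding realizable_def
    using As by (intro exI[of _ "concat (replicate c' As)"])
      (auto simp: cover_count_concat_replicate intro!: cong_mult)
qed

lemma realizable_sum:
  assumes "finite V" "\<And>v. v \<in> V \<Longrightarrow> realizable r n (f v)" "r > 0"
  shows "realizable r n (\<lambda>x. \<Sum>v\<in>V. c v * f v x)"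
  using assms
  by (induction V rule: finite_induct) (auto intro!: realizable_zero realizable_add realizable_scale)

text \<open>The copy of the cover of \<open>cube n\<close> in the slice with second coordinate
  \<open>y\<close> gets the coefficient \<open>g y\<close>, so the other factor can be an arbitrary
  function.\<close>

lemma realizable_lift_fst:
  assumes "realizable r n f" "r > 0"
  shows "realizable r (n + m) (\<lambda>z. f (take n z) * g (drop n z))"
proof -
  obtain As where As: "\<And>A. A \<in> set As \<Longrightarrow> good n A"
    "\<And>x. x \<in> cube n \<Longrightarrow> [int (cover_count As x) = f x] (mod int r)"
    using assms(1) unfolding realizable_def by blast
  have "realizable r (n + m) (\<lambda>z. f (take n z) * of_bool (drop n z = y))" if y: "y \<in> cube m" for y
    unfolding realizable_def
  proof (intro exI conjI ballI)
    show "good (n + m) B" if "B \<in> set (map (\<lambda>A. cat (A \<times> {y})) As)" for B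
      using that As(1) y good_times_left[of n _ "{y}" m] by auto
    fix z assume "z \<in> cube (n + m)"
    then obtain a b where z: "z = a @ b" "a \<in> cube n" "b \<in> cube m" by (rule cubeE)
    have "z \<in> cat (A \<times> {y}) \<longleftrightarrow> a \<in> A \<and> b = y" if "A \<in> set As" for A
      unfolding z(1)
      by (subst append_mem_cat_iff[of _ n m]) (use that z y good_subset[OF As(1)] in auto)
    then have "cover_count (map (\<lambda>A. cat (A \<times> {y})) As) z = (if b = y then cover_count As a else 0)"
      by (auto simp: cover_count_def filter_map comp_def cong: filter_cong)
    moreover have "take n z = a" "drop n z = b" using z by (auto simp: cube_def)
    ultimately show "[int (cover_count (map (\<lambda>A. cat (A \<times> {y})) As) z)
        = f (take n z) * of_bool (drop n z = y)] (mod int r)"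
      using As(2)[OF z(2)] by simp
  qed
  then have "realizable r (n + m) (\<lambda>z. \<Sum>y\<in>cube m. g y * (f (take n z) * of_bool (drop n z = y)))"
    using assms(2) by (intro realizable_sum) auto
  then show ?thesis
  proof (rule realizable_eq)
    fix z assume "z \<in> cube (n + m)"
    then have "drop n z \<in> cube m" by (auto simp: cube_def)
    then show "(\<Sum>y\<in>cube m. g y * (f (take n z) * of_bool (drop n z = y))) = f (take n z) * g (drop n z)"
      by (subst sum.remove[of _ "drop n z"]) (auto intro!: sum.neutral)
  qed
qed

lemma realizable_lift_snd:
  assumes "realizable r m f" "r > 0"
  shows "realizable r (n + m) (\<lambda>z. g (take n z) * f (drop n z))"
proof -
  obtain As where As: "\<And>A. A \<in> set As \<Longrightarrow> good m A"
    "\<And>x. x \<in> cube m \<Longrightarrow> [int (cover_count As x) = f x] (mod int r)"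
    using assms(1) unfolding realizable_def by blast
  have "realizable r (n + m) (\<lambda>z. f (drop n z) * of_bool (take n z = y))" if y: "y \<in> cube n" for y
    unfolding realizable_def
  proof (intro exI conjI ballI)
    show "good (n + m) B" if "B \<in> set (map (\<lambda>A. cat ({y} \<times> A)) As)" for B
      using that As(1) y good_times_right[of "{y}" n m] by auto
    fix z assume "z \<in> cube (n + m)"
    then obtain a b where z: "z = a @ b" "a \<in> cube n" "b \<in> cube m" by (rule cubeE)
    have "z \<in> cat ({y} \<times> A) \<longleftrightarrow> b \<in> A \<and> a = y" if "A \<in> set As" for A
      unfolding z(1)
      by (subst append_mem_cat_iff[of _ n m]) (use that z y good_subset[OF As(1)] in auto)
    then have "cover_count (map (\<lambda>A. cat ({y} \<times> A)) As) z = (if a = y then cover_count As b else 0)"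
      by (auto simp: cover_count_def filter_map comp_def cong: filter_cong)
    moreover have "take n z = a" "drop n z = b" using z by (auto simp: cube_def)
    ultimately show "[int (cover_count (map (\<lambda>A. cat ({y} \<times> A)) As) z)
        = f (drop n z) * of_bool (take n z = y)] (mod int r)"
      using As(2)[OF z(3)] by simp
  qed
  then have "realizable r (n + m) (\<lambda>z. \<Sum>y\<in>cube n. g y * (f (drop n z) * of_bool (take n z = y)))"
    using assms(2) by (intro realizable_sum) auto
  then show ?thesis
  proof (rule realizable_eq)
    fix z assume "z \<in> cube (n + m)"
    then have "take n z \<in> cube n" by (auto simp: cube_def)
    then show "(\<Sum>y\<in>cube n. g y * (f (drop n z) * of_bool (take n z = y))) = g (take n z) * f (drop n z)"
      by (subst sum.remove[of _ "take n z"]) (auto intro!: sum.neutral)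
  qed
qed

text \<open>Induction on \<open>j\<close>, from the empty cover: \<open>1 - h\<close> is divisible
  by \<open>2 ^ j\<close> and \<open>1 - f\<close> by 2, so their product gains a factor 2. One
  minus this product is \<open>h + f - h * f\<close>, in which every summand has a realizable
  factor.\<close>

lemma realizable_one_mod_power_2:
  assumes f: "realizable r k f" "r > 0" and odd: "\<And>x. x \<in> cube k \<Longrightarrow> odd (f x)"
  shows "\<exists>n h. realizable r n h \<and> (\<forall>x\<in>cube n. [h x = 1] (mod 2 ^ j))"
proof (induction j)
  case 0
  show ?case using realizable_zero by auto
next
  case (Suc j)
  then obtain n h where h: "realizable r n h" "\<And>x. x \<in> cube n \<Longrightarrow> [h x = 1] (mod 2 ^ j)" by blast
  \<comment> \<open>\<open>1 - h' = (1 - h) (1 - f)\<close>\<close>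
  define h' where "h' z = h (take n z) * 1 + 1 * f (drop n z) + h (take n z) * - f (drop n z)" for z
  have "realizable r (n + k) h'"
    unfolding h'_def
    by (intro realizable_add realizable_lift_fst[OF h(1) f(2), of _ "\<lambda>_. 1"]
        realizable_lift_snd[OF f, of _ "\<lambda>_. 1"] realizable_lift_fst[OF h(1) f(2), of _ "\<lambda>z. - f z"])
  moreover have "[h' z = 1] (mod 2 ^ Suc j)" if "z \<in> cube (n + k)" for z
  proof -
    have "take n z \<in> cube n" "drop n z \<in> cube k" using that by (auto simp: cube_def)
    then have "2 ^ j dvd h (take n z) - 1" "2 dvd f (drop n z) - 1"
      using h(2) odd by (auto simp: cong_iff_dvd_diff)
    then have "2 ^ j * 2 dvd (h (take n z) - 1) * (f (drop n z) - 1)" by (rule mult_dvd_mono)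
    also have "(h (take n z) - 1) * (f (drop n z) - 1) = - (h' z - 1)"
      by (simp add: h'_def algebra_simps)
    finally show ?thesis by (simp add: cong_iff_dvd_diff mult.commute dvd_diff_commute)
  qed
  ultimately show ?case by blast
qed

text \<open>As \<open>r > 0\<close>, the complements of the covering sets have no common point. They
  yield two disjoint cogood sets, and these yield one for each member of \<open>As\<close>;
  \<open>disjoint_cogoods_good_union\<close> then turns the multiplicity \<open>r\<close> into
  \<open>r\<close> disjoint cogood sets with good union.\<close>

lemma splittable_Suc_cover:
  assumes As: "\<And>A. A \<in> set As \<Longrightarrow> good k A" and r: "\<And>x. x \<in> cube k \<Longrightarrow> cover_count As x = r"
    and "r > 0"
  shows "splittable (Suc r)"
proof -
  define M where "M = length As"
  have A: "good k (As ! i)" if "i < M" for i using As that by (simp add: M_def)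
  \<comment> \<open>Two copies of the whole cube are added, at indices \<open>M\<close> and
    \<open>M + 1\<close>: \<open>two_disjoint_cogood\<close> asks for at least two sets, and a
    common point is thereby forced into \<open>cube k\<close>.\<close>
  define D where "D i = (if i < M then cube k - As ! i else cube k)" for i
  have "cogood k (D i)" for i
    using A[of i] good_subset[OF A, of i] by (auto simp: D_def cogood_def double_diff)
  moreover have "(\<Inter>i<M + 2. D i) = {}"
  proof (rule ccontr)
    assume "(\<Inter>i<M + 2. D i) \<noteq> {}"
    then obtain x where x: "\<And>i. i < M + 2 \<Longrightarrow> x \<in> D i" by blast
    then have "x \<in> cube k" using x[of M] by (simp add: D_def)
    then have "card {i. i < M \<and> x \<in> As ! i} > 0"
      using r assms(3) by (simp add: cover_count_conv_card M_def)
    then obtain i where "i < M" "x \<in> As ! i" by (auto simp: card_gt_0_iff)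
    then show False using x[of i] by (simp add: D_def)
  qed
  ultimately obtain n E F where EF: "cogood n E" "cogood n F" "E \<inter> F = {}"
    using two_disjoint_cogood[of "M + 2" k D] by auto
  then obtain d G where G: "\<And>i. i < M \<Longrightarrow> cogood d (G i)" "disjoint_family_on G {..<M}"
    using disjoint_cogoods by blast
  have "card {i. i < M \<and> x \<in> As ! i} = r" if "x \<in> cube k" for x
    using r[OF that] by (simp add: cover_count_conv_card M_def)
  then have "\<exists>e C. (\<forall>l<r. cogood e (C l)) \<and> disjoint_family_on C {..<r} \<and> good e (\<Union>l<r. C l)"
    by (intro disjoint_cogoods_good_union[of M d G k "\<lambda>i. As ! i"] G A)
  then obtain e C where "\<And>l. l < r \<Longrightarrow> cogood e (C l)" "disjoint_family_on C {..<r}" "good e (\<Union>l<r. C l)"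
    by blast
  then show ?thesis using splittable_Suc_if_good_union[OF EF] by blast
qed

end

subsection \<open>Translates and isometric copies\<close>

text \<open>Translation in the group \<open>(Z/2)^n\<close>.\<close>

definition xor_list :: "bool list \<Rightarrow> bool list \<Rightarrow> bool list" where
  "xor_list u v = map2 (\<noteq>) u v"

definition hdist :: "'a list \<Rightarrow> 'a list \<Rightarrow> nat" where
  "hdist u v = length (filter (\<lambda>(a, b). a \<noteq> b) (zip u v))"

lemma xor_list_mem_cube: "u \<in> cube n \<Longrightarrow> v \<in> cube n \<Longrightarrow> xor_list u v \<in> cube n"
  by (simp add: cube_def xor_list_def)

lemma xor_list_commute: "xor_list u v = xor_list v u"
  unfolding xor_list_def by (subst zip_commute) (auto simp: comp_def)

lemma xor_list_cancel: "length u = length v \<Longrightarrow> xor_list u (xor_list u v) = v"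
  by (induction u v rule: list_induct2) (auto simp: xor_list_def)

lemma xor_list_cancel_cube: "u \<in> cube n \<Longrightarrow> v \<in> cube n \<Longrightarrow> xor_list u (xor_list u v) = v"
  by (simp add: cube_def xor_list_cancel)

lemma inj_on_xor_list: "u \<in> cube n \<Longrightarrow> inj_on (xor_list u) (cube n)"
  by (metis inj_onI xor_list_cancel_cube)

lemma mem_xor_list_image_iff:
  assumes "X \<subseteq> cube n" "u \<in> cube n" "x \<in> cube n"
  shows "x \<in> xor_list u ` X \<longleftrightarrow> xor_list u x \<in> X"
  using assms xor_list_cancel_cube[of u n] by (auto simp: image_iff subset_iff) metis

lemma hdist_xor_list:
  "length w = length u \<Longrightarrow> length u = length v \<Longrightarrow> hdist (xor_list w u) (xor_list w v) = hdist u v"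
  by (induction w u v rule: list_induct3) (auto simp: hdist_def xor_list_def)

lemma hdist_append: "length a = length b \<Longrightarrow> hdist (a @ c) (b @ d) = hdist a b + hdist c d"
  by (simp add: hdist_def)

lemma hdist_self [simp]: "hdist a a = 0"
  by (induction a) (auto simp: hdist_def)

section \<open>Odd integer combinations of translates\<close>

lemma sum_cube_Suc:
  "(\<Sum>v\<in>cube (Suc k). g v) = (\<Sum>v\<in>cube k. g (False # v)) + (\<Sum>v\<in>cube k. g (True # v))"
  for g :: "bool list \<Rightarrow> 'a::comm_monoid_add"
  unfolding cube_Suc by (subst sum.union_disjoint) (auto simp: sum.reindex)

text \<open>Modulo 2, the span of the translates of a nonzero function on \<open>(Z/2)^k\<close>
  contains the constant 1. The induction removes the first coordinate: if the sum \<open>?q\<close>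
  of the two halves is odd somewhere, it takes the place of \<open>p\<close>; otherwise
  \<open>p\<close> modulo 2 does not depend on that coordinate.\<close>

lemma odd_combination_of_translates:
  fixes p :: "bool list \<Rightarrow> int"
  assumes "x \<in> cube k" "odd (p x)"
  shows "\<exists>c :: bool list \<Rightarrow> int. \<forall>x\<in>cube k. odd (\<Sum>v\<in>cube k. c v * p (xor_list v x))"
  using assms
proof (induction k arbitrary: p x)
  case 0
  then show ?case by (intro exI[of _ "\<lambda>_. 1"]) (simp add: xor_list_def)
next
  case (Suc k)
  let ?q = "\<lambda>y. p (False # y) + p (True # y)"
  have xor: "xor_list (a # v) (b # y) = (a \<noteq> b) # xor_list v y" for a b v y
    by (simp add: xor_list_def)
  show ?case
  proof (cases "\<exists>y\<in>cube k. odd (?q y)")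
    case True
    then obtain c where c: "\<And>y. y \<in> cube k \<Longrightarrow> odd (\<Sum>v\<in>cube k. c v * ?q (xor_list v y))"
      using Suc.IH[of _ ?q] by blast
    show ?thesis
    proof (intro exI ballI)
      fix z assume "z \<in> cube (Suc k)"
      then obtain b y where z: "z = b # y" "y \<in> cube k" by (auto simp: cube_Suc)
      \<comment> \<open>The coefficient ignores the head of \<open>v\<close>, so the two heads
        together produce \<open>?q\<close>, whatever \<open>b\<close> is.\<close>
      have "(\<Sum>v\<in>cube (Suc k). c (tl v) * p (xor_list v z)) = (\<Sum>v\<in>cube k. c v * ?q (xor_list v y))"
        unfolding sum_cube_Suc z(1) xor by (cases b) (simp_all add: algebra_simps sum.distrib)
      then show "odd (\<Sum>v\<in>cube (Suc k). c (tl v) * p (xor_list v z))" using c[OF z(2)] by simp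
    qed
  next
    case False
    then have ev: "even (p (False # y)) \<longleftrightarrow> even (p (True # y))" if "y \<in> cube k" for y using that by simp
    obtain b y where "x = b # y" "y \<in> cube k" using Suc.prems by (auto simp: cube_Suc)
    then have y: "y \<in> cube k" "odd (p (False # y))" using Suc.prems ev[of y] by (cases b; simp)+
    obtain c where c: "\<And>y. y \<in> cube k \<Longrightarrow> odd (\<Sum>v\<in>cube k. c v * p (False # xor_list v y))"
      using Suc.IH[of y "\<lambda>y. p (False # y)"] y by blast
    show ?thesis
    proof (intro exI ballI)
      fix z assume "z \<in> cube (Suc k)"
      then obtain b y where z: "z = b # y" "y \<in> cube k" by (auto simp: cube_Suc)
      \<comment> \<open>Equal coefficients for both heads would cancel modulo 2 by
        \<open>ev\<close>, so only the head \<open>False\<close> gets one.\<close>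
      have "(\<Sum>v\<in>cube (Suc k). (if hd v then 0 else c (tl v)) * p (xor_list v z))
          = (\<Sum>v\<in>cube k. c v * p (b # xor_list v y))"
        unfolding sum_cube_Suc z(1) xor by simp
      moreover have "even (\<Sum>v\<in>cube k. c v * p (b # xor_list v y)) \<longleftrightarrow>
          even (\<Sum>v\<in>cube k. c v * p (False # xor_list v y))"
      proof -
        have "even (\<Sum>v\<in>cube k. c v * (p (b # xor_list v y) - p (False # xor_list v y)))"
        proof (rule dvd_sum)
          fix v assume "v \<in> cube k"
          then have "xor_list v y \<in> cube k" using z(2) by (rule xor_list_mem_cube)
          from ev[OF this] show "even (c v * (p (b # xor_list v y) - p (False # xor_list v y)))"
            by (cases b) auto
        qed
        then show ?thesis by (simp add: right_diff_distrib sum_subtractf)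
      qed
      ultimately show "odd (\<Sum>v\<in>cube (Suc k). (if hd v then 0 else c (tl v)) * p (xor_list v z))"
        using c[OF z(2)] by simp
    qed
  qed
qed

lemma (in cube_tiles) good_cube_of_translates:
  assumes X: "X \<subseteq> cube k" "card X = 2 ^ m" and tile: "\<And>v. v \<in> cube k \<Longrightarrow> tile k (xor_list v ` X)"
  shows "\<exists>n. good n (cube n)"
proof -
  obtain vs where vs: "set vs = cube k" "distinct vs" using finite_distinct_list[OF finite_cube] by blast
  define Rs where "Rs = map (\<lambda>v. xor_list v ` X) vs"
  have "cover_count Rs x = 2 ^ m" if x: "x \<in> cube k" for x
  proof -
    have "cover_count Rs x = length (filter (\<lambda>v. x \<in> xor_list v ` X) vs)"
      by (simp add: cover_count_def Rs_def filter_map comp_def)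
    also have "\<dots> = card {v \<in> cube k. x \<in> xor_list v ` X}"
      using vs by (simp add: distinct_card[symmetric])
    \<comment> \<open>In group notation, \<open>x\<close> lies in \<open>v + X\<close> exactly when
      \<open>v\<close> lies in \<open>x + X\<close>.\<close>
    also have "{v \<in> cube k. x \<in> xor_list v ` X} = xor_list x ` X"
    proof -
      have "xor_list x ` X \<subseteq> cube k" using X(1) x xor_list_mem_cube by blast
      moreover have "x \<in> xor_list v ` X \<longleftrightarrow> v \<in> xor_list x ` X" if "v \<in> cube k" for v
        using mem_xor_list_image_iff[OF X(1)] x that xor_list_commute by metis
      ultimately show ?thesis by blast
    qed
    also have "card (xor_list x ` X) = 2 ^ m"
      using card_image[OF inj_on_subset[OF inj_on_xor_list[OF x] X(1)]] X(2) by simp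
    finally show ?thesis .
  qed
  then have split: "splittable (Suc (2 ^ m))"
    by (intro splittable_Suc_cover[of Rs k]) (use tile good_tile vs in \<open>auto simp: Rs_def\<close>)
  have "X \<noteq> {}" using X(2) by auto
  then obtain x where "x \<in> X" by blast
  then obtain c :: "bool list \<Rightarrow> int"
    where c: "\<And>x. x \<in> cube k \<Longrightarrow> odd (\<Sum>v\<in>cube k. c v * of_bool (xor_list v x \<in> X))"
    using odd_combination_of_translates[of x k "\<lambda>x. of_bool (x \<in> X)"] X(1) by auto
  define f where "f x = (\<Sum>v\<in>cube k. c v * of_bool (x \<in> xor_list v ` X))" for x
  \<comment> \<open>modulus \<open>2\<^bsup>m+1\<^esup>\<close> rather than \<open>2\<^sup>m\<close>: for \<open>m = 0\<close> a count \<open>1 (mod 1)\<close> could be zero\<close>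
  have "realizable (2 ^ Suc m) k f"
    unfolding f_def by (intro realizable_sum realizable_good good_tile tile) auto
  moreover have "odd (f x)" if "x \<in> cube k" for x
    using c[OF that] that mem_xor_list_image_iff[OF X(1)] by (simp add: f_def cong: sum.cong)
  ultimately obtain n h
    where h: "realizable (2 ^ Suc m) n h" "\<And>x. x \<in> cube n \<Longrightarrow> [h x = 1] (mod 2 ^ Suc m)"
    using realizable_one_mod_power_2[of "2 ^ Suc m" k f "Suc m"] by auto
  obtain As where As: "\<And>A. A \<in> set As \<Longrightarrow> good n A"
    "\<And>x. x \<in> cube n \<Longrightarrow> [int (cover_count As x) = h x] (mod int (2 ^ Suc m))"
    using h(1) unfolding realizable_def by blast
  have "splittable (cover_count As x)" if x: "x \<in> cube n" for x
  proof -
    have "[int (cover_count As x) = int 1] (mod int (2 ^ Suc m))"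
      using cong_trans[OF As(2)[OF x]] h(2)[OF x] by simp
    then have "[cover_count As x = 1] (mod 2 ^ Suc m)" by (simp only: cong_int_iff)
    then have "cover_count As x mod 2 ^ Suc m = 1" by (simp add: cong_def)
    \<comment> \<open>The factor 2 arises because the count is known modulo
      \<open>2 ^ Suc m\<close>, while the progression from \<open>split\<close> has difference
      \<open>2 ^ m\<close>.\<close>
    then have "cover_count As x = Suc (2 ^ m * (2 * (cover_count As x div 2 ^ Suc m)))"
      using div_mult_mod_eq[of "cover_count As x" "2 ^ Suc m"] by (simp add: ac_simps)
    then show ?thesis using splittable_arith_prog[OF split] by metis
  qed
  then show ?thesis
    using good_cube_if_splittable[of "length As" n "\<lambda>i. As ! i"] As(1)
    by (simp add: cover_count_conv_card)
qed

text \<open>Distances are those of the ambient cube, not of the graph \<open>H\<close>. They are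
  translation invariant and additive under concatenation, so copies are easily moved between cubes;
  adjacency is distance 1, so copies induce isomorphic graphs.\<close>

definition isometric_copy :: "bool list set \<Rightarrow> nat \<Rightarrow> bool list set \<Rightarrow> bool" where
  "isometric_copy X n A \<longleftrightarrow> A \<subseteq> cube n \<and>
     (\<exists>f. bij_betw f X A \<and> (\<forall>x\<in>X. \<forall>y\<in>X. hdist (f x) (f y) = hdist x y))"

lemma isometric_copy_image:
  assumes "isometric_copy X n A" "g ` A \<subseteq> cube m" "inj_on g A"
    and "\<And>x y. x \<in> A \<Longrightarrow> y \<in> A \<Longrightarrow> hdist (g x) (g y) = hdist x y"
  shows "isometric_copy X m (g ` A)"
proof -
  obtain f where f: "bij_betw f X A" "\<forall>x\<in>X. \<forall>y\<in>X. hdist (f x) (f y) = hdist x y"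
    using assms(1) unfolding isometric_copy_def by blast
  have "bij_betw (g \<circ> f) X (g ` A)"
    using f(1) inj_on_imp_bij_betw[OF assms(3)] by (rule bij_betw_trans)
  moreover have "\<forall>x\<in>X. \<forall>y\<in>X. hdist ((g \<circ> f) x) ((g \<circ> f) y) = hdist x y"
    using f assms(4) bij_betwE[OF f(1)] by simp
  ultimately show ?thesis unfolding isometric_copy_def using assms(2) by blast
qed

lemma isometric_copy_refl: "X \<subseteq> cube k \<Longrightarrow> isometric_copy X k X"
  unfolding isometric_copy_def by (intro conjI exI[of _ id]) auto

lemma cube_tiles_isometric_copy:
  assumes "X \<noteq> {}"
  shows "cube_tiles (isometric_copy X)"
proof
  fix n m A and z :: "bool list"
  assume A: "isometric_copy X n A"
  show sub: "A \<subseteq> cube n" using A by (simp add: isometric_copy_def)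
  show "A \<noteq> {}" using A assms by (auto simp: isometric_copy_def bij_betw_def)
  assume z: "z \<in> cube m"
  show "isometric_copy X (n + m) ((\<lambda>a. a @ z) ` A)"
    by (rule isometric_copy_image[OF A]) (use sub z in \<open>auto simp: cube_def hdist_append subset_iff inj_on_def\<close>)
  show "isometric_copy X (m + n) ((\<lambda>a. z @ a) ` A)"
    by (rule isometric_copy_image[OF A]) (use sub z in \<open>auto simp: cube_def hdist_append subset_iff inj_on_def\<close>)
qed

section \<open>Hypercubes as digraphs, and isometric copies as \<open>H\<close>-sets\<close>

lemma arcs_hypercube:
  "arcs (with_proj (hypercube n)) = {(u, v). u \<in> cube n \<and> v \<in> cube n \<and> hdist u v = 1}"
proof -
  have "hdist u v = 1 \<longleftrightarrow> (\<exists>!i. i < n \<and> u ! i \<noteq> v ! i)" if "length u = n" "length v = n" for u v :: "bool list"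
  proof -
    have "hdist u v = card {i. i < n \<and> u ! i \<noteq> v ! i}"
      unfolding hdist_def length_filter_conv_card using that by (simp cong: conj_cong)
    moreover have "card S = 1 \<longleftrightarrow> (\<exists>!i. i \<in> S)" for S :: "nat set"
      unfolding One_nat_def card_1_singleton_iff by blast
    ultimately show ?thesis by simp
  qed
  then show ?thesis by (auto simp: hypercube_def cube_def)
qed

lemma verts_hypercube: "verts (with_proj (hypercube n)) = cube n"
  by (simp add: hypercube_def cube_def)

text \<open>\<open>digraph_iso\<close> asks that \<open>H\<close> equal an image of the restriction
  as a record. Its tail and head are \<open>fst\<close> and \<open>snd\<close> because an induced
  subgraph is compatible with the hypercube.\<close>

lemma H_set_isometric_copy:
  assumes H: "induced_subgraph H (with_proj (hypercube k))" and A: "isometric_copy (verts H) n A"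
  shows "H_set H (with_proj (hypercube n)) A"
proof -
  let ?X = "verts H" and ?G = "with_proj (hypercube n) \<restriction> A"
  obtain f where f: "bij_betw f ?X A" "\<And>x y. x \<in> ?X \<Longrightarrow> y \<in> ?X \<Longrightarrow> hdist (f x) (f y) = hdist x y"
    and sub: "A \<subseteq> cube n"
    using A unfolding isometric_copy_def by blast
  \<comment> \<open>The isomorphism has to run from the restriction to \<open>H\<close>, so its
    vertex map is the inverse of \<open>f\<close>.\<close>
  define g where "g = the_inv_into ?X f"
  have g: "bij_betw g A ?X" unfolding g_def by (rule bij_betw_the_inv_into[OF f(1)])
  have fg: "f (g a) = a" if "a \<in> A" for a
    unfolding g_def using f(1) that by (rule f_the_inv_into_f_bij_betw)
  have gX: "g a \<in> ?X" if "a \<in> A" for a using g that bij_betwE by blast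
  have hg: "hdist (g a) (g b) = hdist a b" if "a \<in> A" "b \<in> A" for a b
    using f(2)[OF gX gX, of a b] fg that by simp
  have sgr: "verts H \<subseteq> cube k" "tail H = fst" "head H = snd"
    and arcsH: "arcs H = {(u, v). u \<in> ?X \<and> v \<in> ?X \<and> hdist u v = 1}"
    using H unfolding induced_subgraph_def subgraph_def compatible_def verts_hypercube arcs_hypercube
    by auto
  have G: "verts ?G = A" "arcs ?G = {(u, v). u \<in> A \<and> v \<in> A \<and> hdist u v = 1}"
    "tail ?G = fst" "head ?G = snd"
    unfolding induce_subgraph_def arcs_hypercube using sub by auto
  define hom where "hom = \<lparr>iso_verts = g, iso_arcs = map_prod g g, iso_head = snd, iso_tail = fst\<rparr>"
  have "pre_digraph.digraph_isomorphism ?G hom"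
    unfolding pre_digraph.digraph_isomorphism_def
  proof (intro conjI ballI)
    show "wf_digraph ?G" by unfold_locales (auto simp: G)
    show "inj_on (iso_verts hom) (verts ?G)" using g by (simp add: G hom_def bij_betw_def)
    show "inj_on (iso_arcs hom) (arcs ?G)"
      using bij_betw_imp_inj_on[OF g] by (auto simp: G hom_def inj_on_def)
  qed (auto simp: G hom_def)
  moreover have "H = app_iso hom ?G"
  proof (rule pre_digraph.equality)
    show "verts H = verts (app_iso hom ?G)" using g by (simp add: G hom_def bij_betw_def)
    show "arcs H = arcs (app_iso hom ?G)"
    proof -
      have "arcs (app_iso hom ?G) = map_prod g g ` {(u, v). u \<in> A \<and> v \<in> A \<and> hdist u v = 1}"
        by (simp only: arcs_app_iso G(2)) (simp add: hom_def)
      also have "\<dots> = {(u, v). u \<in> ?X \<and> v \<in> ?X \<and> hdist u v = 1}"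
      proof (intro equalityI subsetI)
        fix e assume "e \<in> {(u, v). u \<in> ?X \<and> v \<in> ?X \<and> hdist u v = 1}"
        then obtain u v where e: "e = (u, v)" "u \<in> ?X" "v \<in> ?X" "hdist u v = 1" by blast
        have gf: "g (f x) = x" "f x \<in> A" if "x \<in> ?X" for x
          using f(1) that by (auto simp: g_def bij_betw_def the_inv_into_f_f)
        show "e \<in> map_prod g g ` {(u, v). u \<in> A \<and> v \<in> A \<and> hdist u v = 1}"
          by (rule image_eqI[of _ _ "(f u, f v)"]) (use e gf f(2) in auto)
      qed (auto simp: gX hg)
      finally show ?thesis using arcsH by simp
    qed
  qed (auto simp: hom_def sgr)
  ultimately show ?thesis
    unfolding H_set_def digraph_iso_def using sub verts_hypercube by auto
qed

theorem theorem1: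
  fixes k :: nat and H :: "(bool list, bool list \<times> bool list) pre_digraph"
  assumes "k > 0"
    and "induced_subgraph H (hypercube k)"
    and "\<exists>m. card (verts H) = 2 ^ m"
  shows "\<exists>n>0. \<exists>P. partition_on (verts (hypercube n)) P \<and> (\<forall>A\<in>P. H_set H (hypercube n) A)"
proof -
  let ?X = "verts H"
  obtain m where m: "card ?X = 2 ^ m" using assms(3) by blast
  then have "?X \<noteq> {}" by auto
  then interpret cube_tiles "isometric_copy ?X" by (rule cube_tiles_isometric_copy)
  have X: "?X \<subseteq> cube k"
    using assms(2) unfolding induced_subgraph_def subgraph_def verts_hypercube by blast
  have "isometric_copy ?X k (xor_list v ` ?X)" if v: "v \<in> cube k" for v
  proof (rule isometric_copy_image[OF isometric_copy_refl[OF X]])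
    show "xor_list v ` ?X \<subseteq> cube k" using X v xor_list_mem_cube by blast
    show "inj_on (xor_list v) ?X" using inj_on_xor_list[OF v] X by (rule inj_on_subset)
    show "hdist (xor_list v x) (xor_list v y) = hdist x y" if "x \<in> ?X" "y \<in> ?X" for x y
      using that X v by (intro hdist_xor_list) (auto simp: cube_def subset_iff)
  qed
  then obtain n where "good n (cube n)" using good_cube_of_translates[OF X m] by blast
  \<comment> \<open>One more coordinate makes the dimension positive, as \<open>n\<close> may be
    0.\<close>
  then have "good (n + 1) (cube (n + 1))"
    using good_times_left[of n "cube n" "cube 1" 1] by (simp add: cat_cube)
  then obtain P where "partition_on (cube (n + 1)) P" "\<forall>A\<in>P. isometric_copy ?X (n + 1) A"
    unfolding good_def by blast
  then show ?thesis
    using H_set_isometric_copy[OF assms(2)] verts_hypercube by (intro exI[of _ "n + 1"]) auto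
qed

end
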